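(* Let $\alpha \ge 1$. For every $f \in C_\infty^{2}([0,\infty))$, $$\lim_{n\to\infty} \big\| n(\mathcal{P}_n f - f) - \mathcal{A} f \big\|_{\infty, w_\alpha} = 0,$$ where $\mathcal{P}_n$ is the Szász–Mirakyan operator and $\mathcal{A}$ is the degenerate differential operator $\mathcal{A}f(x) = \frac{x}{2} f''(x)$ for $x>0$, $\mathcal{A}f(0)=0$. Moreover, for every $\alpha > 3/2$, every $f \in C_\infty^2([0,\infty))$ with $f'' \in \mathrm{Lip}([0,\infty))$, and every $n \in \mathbb{N}$, $$\big\| n(\mathcal{P}_n f - f) - \mathcal{A} f \big\|_{\infty, w_\alpha} \le \frac{1}{6\sqrt{n}}\, M_\alpha\, \mathrm{Lip}(f''),$$ where $$M_\alpha := \frac{3^{3/4}(2\alpha-3)}{2\alpha}\left(\frac{3}{2\alpha-3}\right)^{3/(2\alpha)} + \frac{4\alpha-3}{4\alpha}\left(\frac{3}{4\alpha-3}\right)^{3/(4\alpha)}.$$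
   Context: All functions are real-valued and $\mathbb{N}=\{1,2,3,\dots\}$. Function spaces: $C([0,\infty))$ is the space of continuous functions on $[0,\infty)$; $C_\infty([0,\infty))$ is the space of continuous functions on $[0,\infty)$ vanishing at infinity; $C^r([0,\infty))$ is the space of functions on $[0,\infty)$ having a continuous $r$-th derivative; $C_\infty^r([0,\infty)) := C_\infty([0,\infty)) \cap C^r([0,\infty))$. For $\alpha \ge 1$, $w_\alpha(x) := \frac{1}{1+x^\alpha}$ for $x \in [0,\infty)$. The weighted space is $C_\infty^{w_\alpha}([0,\infty)) := \{ f \in C([0,\infty)) : w_\alpha f \in C_\infty([0,\infty)) \}$, and the weighted norm is $\|f\|_{\infty,w_\alpha} := \sup_{x\in[0,\infty)} |w_\alpha(x) f(x)|$. $\mathrm{Lip}([0,\infty))$ is the set of Lipschitz continuous functions on $[0,\infty)$, and $\mathrm{Lip}(f) := \sup_{x \neq y} \frac{|f(x)-f(y)|}{|x-y|}$ for $f\in\mathrm{Lip}([0,\infty))$. The Szász–Mirakyan operator is, for $n\in\mathbb{N}$, $$\mathcal{P}_n f(x) := \sum_{k=0}^\infty e^{-nx}\frac{(nx)^k}{k!} f\Big(\frac{k}{n}\Big), \qquad x \in [0,\infty).$$ The operator $\mathcal{A}$ is given by the formula in the claim, with domain $$D(\mathcal{A}) = \Big\{ f \in C_\infty^{w_\alpha}([0,\infty)) \cap C^2([0,\infty)) : \lim_{x\to 0+} x f''(x) = \lim_{x\to\infty} w_\alpha(x)\,(x f''(x)) = 0 \Big\}.$$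
   Formalization: The convergence is stated for f in C_∞^2 ∩ D(A), not all of C_∞^2: for f(x)=sin(x^m)/(1+x) with integer m, 2m−2>α, w_α Af is unbounded while n(P_n f − f) is bounded, so the norm is infinite for every n. *)

theory Defs
  imports "HOL-Analysis.Analysis"
begin

text \<open>
  A function on $[0,\infty)$ is represented by a function \<open>real \<Rightarrow> real\<close> of which only the
  values on \<open>{0..}\<close> matter; in particular derivatives are taken within \<open>{0..}\<close>, so that the
  derivative at \<open>0\<close> is the one-sided one.
\<close>

definition deriv0 :: "(real \<Rightarrow> real) \<Rightarrow> real \<Rightarrow> real" where
  "deriv0 f x = vector_derivative f (at x within {0..})"

definition C0 :: "(real \<Rightarrow> real) set" where
  "C0 = {f. continuous_on {0..} f}"

definition C_inf :: "(real \<Rightarrow> real) set" where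
  "C_inf = {f. continuous_on {0..} f \<and> (f \<longlongrightarrow> 0) at_top}"

definition C_r :: "nat \<Rightarrow> (real \<Rightarrow> real) set" where
  "C_r r = {f. (\<forall>k<r. (deriv0 ^^ k) f differentiable_on {0..}) \<and>
               continuous_on {0..} ((deriv0 ^^ r) f)}"

definition C_inf_r :: "nat \<Rightarrow> (real \<Rightarrow> real) set" where
  "C_inf_r r = C_inf \<inter> C_r r"

definition weight :: "real \<Rightarrow> real \<Rightarrow> real" where
  "weight \<alpha> x = 1 / (1 + x powr \<alpha>)"

definition C_inf_w :: "real \<Rightarrow> (real \<Rightarrow> real) set" where
  "C_inf_w \<alpha> = {f \<in> C0. (\<lambda>x. weight \<alpha> x * f x) \<in> C_inf}"

text \<open>
  The norm is \<open>ereal\<close>-valued: it is \<open>\<infinity>\<close> if the weighted function is unbounded on \<open>{0..}\<close>.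
\<close>

definition wnorm :: "real \<Rightarrow> (real \<Rightarrow> real) \<Rightarrow> ereal" where
  "wnorm \<alpha> f = (SUP x\<in>{0..}. ereal \<bar>weight \<alpha> x * f x\<bar>)"

definition Lip :: "(real \<Rightarrow> real) set" where
  "Lip = {f. \<exists>L. L-lipschitz_on {0..} f}"

text \<open>The supremum below is meaningful for \<open>f \<in> Lip\<close>, where the quotients are bounded.\<close>

definition Lip_const :: "(real \<Rightarrow> real) \<Rightarrow> real" where
  "Lip_const f =
     (SUP (x, y)\<in>{(x, y). 0 \<le> x \<and> 0 \<le> y \<and> x \<noteq> y}. \<bar>f x - f y\<bar> / \<bar>x - y\<bar>)"

definition szasz :: "nat \<Rightarrow> (real \<Rightarrow> real) \<Rightarrow> real \<Rightarrow> real" where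
  "szasz n f x =
     (\<Sum>k. exp (- (real n * x)) * (real n * x) ^ k / fact k * f (real k / real n))"

definition A_op :: "(real \<Rightarrow> real) \<Rightarrow> real \<Rightarrow> real" where
  "A_op f x = (if x > 0 then x / 2 * (deriv0 ^^ 2) f x else 0)"

text \<open>
  Only on this domain does \<^const>\<open>A_op\<close> represent the operator
  $\mathcal{A} : D(\mathcal{A}) \to C_\infty^{w_\alpha}([0,\infty))$.  A function in
  $C_\infty^2([0,\infty))$ need not belong to it, since its second derivative may be arbitrarily
  large at infinity.
\<close>

definition A_domain :: "real \<Rightarrow> (real \<Rightarrow> real) set" where
  "A_domain \<alpha> = {f \<in> C_inf_w \<alpha> \<inter> C_r 2.
     ((\<lambda>x. x * (deriv0 ^^ 2) f x) \<longlongrightarrow> 0) (at_right 0) \<and>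
     ((\<lambda>x. weight \<alpha> x * (x * (deriv0 ^^ 2) f x)) \<longlongrightarrow> 0) at_top}"

definition M_const :: "real \<Rightarrow> real" where
  "M_const \<alpha> =
     3 powr (3/4) * (2*\<alpha> - 3) / (2*\<alpha>) * (3 / (2*\<alpha> - 3)) powr (3 / (2*\<alpha>)) +
     (4*\<alpha> - 3) / (4*\<alpha>) * (3 / (4*\<alpha> - 3)) powr (3 / (4*\<alpha>))"

end

theory Submission imports Defs begin

text \<open>
  Write \<open>R\<close> for the second-order Taylor remainder of \<open>f\<close> at \<open>x\<close>. The Szasz operator averages over
  \<open>k / n\<close>, where \<open>k\<close> has the Poisson law of parameter \<open>n x\<close>; this average has first central moment
  \<open>0\<close> and second central moment \<open>x / n\<close>. Applied to the Taylor expansion of \<open>f\<close>, the operator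
  therefore reproduces \<open>f x\<close>, kills the linear term and turns the quadratic term into
  \<open>x f''(x) / (2 n)\<close>. So the Voronovskaya error \<open>n (P\<^sub>n f - f) - A f\<close> at \<open>x\<close> is exactly \<open>n\<close> times
  the average of \<open>R\<close>, and everything reduces to bounding \<open>R\<close> by multiples of \<open>1\<close>, \<open>(t - x)\<^sup>2\<close> and
  \<open>(t - x)^4\<close>, whose averages are known. This is \<open>szasz_error_bound\<close>.

  For the convergence one shows that for each \<open>\<epsilon> > 0\<close> there is a \<open>C\<close> with
  \[ w_\alpha(x) |R(t)| \le \epsilon \frac{(t-x)^2}{1+x} + C \frac{(t-x)^4}{1+x^2} \]
  for all \<open>x, t \<ge> 0\<close> (\<open>weighted_rem_bound\<close>). Since the fourth central moment is
  \<open>(3 x\<^sup>2 + x / n) / n\<^sup>2\<close>, this makes the weighted error at most \<open>\<epsilon> + 4 C / n\<close>, uniformly in \<open>x\<close>.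
  For \<open>x\<close> in a bounded interval the estimate is the usual one, by uniform continuity of \<open>f''\<close>. For
  large \<open>x\<close> the operator domain gives \<open>f''(x) = o(x^(\<alpha> - 1))\<close>, which controls \<open>R\<close> as long as \<open>t\<close> is
  comparable to \<open>x\<close>; for the other \<open>t\<close> the distance \<open>|t - x|\<close> is at least \<open>x / 2\<close>, and then the
  fourth power dominates, as \<open>f\<close> and \<open>w\<^sub>\<alpha> f'\<close> are bounded.

  For the quantitative bound, Lipschitz continuity of \<open>f''\<close> gives
  \<open>|R(t)| \<le> Lip(f'') |t - x|^3 / 6\<close>. The third absolute moment is at most the fourth one to the
  power \<open>3/4\<close>, which splits into a multiple of \<open>x^(3/2)\<close> and one of \<open>x^(3/4)\<close>; the two summands of
  \<open>M_const \<alpha>\<close> come from the maxima of \<open>w\<^sub>\<alpha>(x) x^(3/2)\<close> and \<open>w\<^sub>\<alpha>(x) x^(3/4)\<close>.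
\<close>

section \<open>Central moments of the Szasz operator\<close>

definition poisson :: "real \<Rightarrow> nat \<Rightarrow> real" where
  "poisson l k = exp (- l) * l ^ k / fact k"

lemma poisson_nonneg: "l \<ge> 0 \<Longrightarrow> poisson l k \<ge> 0"
  by (simp add: poisson_def)

lemma poisson_sums_1: "poisson l sums 1"
proof -
  have "(\<lambda>k. exp (-l) * (l ^ k /\<^sub>R fact k)) sums (exp (-l) * exp l)"
    by (intro sums_mult exp_converges)
  moreover have "exp (-l) * exp l = 1" by (simp add: exp_minus)
  moreover have "(\<lambda>k. exp (-l) * (l ^ k /\<^sub>R fact k)) = poisson l"
    by (auto simp: poisson_def divide_inverse)
  ultimately show ?thesis by simp
qed

text \<open>
  The identity \<open>l p\<^sub>k = (k + 1) p\<^sub>k\<^sub>+\<^sub>1\<close> for the Poisson weights, in summed form (Stein's identity). It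
  yields each moment from lower ones.
\<close>

lemma poisson_sums_shift:
  assumes "(\<lambda>k. poisson l k * g (Suc k)) sums s"
  shows "(\<lambda>k. poisson l k * (real k * g k)) sums (l * s)"
proof -
  have "l * (poisson l k * g (Suc k)) = poisson l (Suc k) * (real (Suc k) * g (Suc k))" for k
  proof -
    have "poisson l (Suc k) * real (Suc k) = l * poisson l k"
      unfolding poisson_def fact_Suc by (simp add: field_simps del: of_nat_Suc)
    then show ?thesis by (metis mult.assoc)
  qed
  with sums_mult[OF assms, of l]
  have "(\<lambda>k. poisson l (Suc k) * (real (Suc k) * g (Suc k))) sums (l * s)" by simp
  then show ?thesis by (subst (asm) sums_Suc_iff) simp
qed

lemma poisson_moments:
  shows "(\<lambda>k. poisson l k * (real k - l)) sums 0"
    and "(\<lambda>k. poisson l k * (real k - l)^2) sums l"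
    and "(\<lambda>k. poisson l k * (real k - l)^4) sums (3 * l^2 + l)"
proof -
  note p0 = poisson_sums_1[of l]
  have p1: "(\<lambda>k. poisson l k * real k) sums l"
    using poisson_sums_shift[of l "\<lambda>_. 1" 1] p0 by simp
  have p2: "(\<lambda>k. poisson l k * real k ^ 2) sums (l * (l + 1))"
    using poisson_sums_shift[of l "\<lambda>k. real k" "l + 1"] sums_add[OF p1 p0]
    by (simp add: algebra_simps power2_eq_square)
  have "(\<lambda>k. poisson l k * real k ^ 2 + 2 * (poisson l k * real k) + poisson l k)
          sums (l * (l + 1) + 2 * l + 1)"
    by (intro sums_add sums_mult p0 p1 p2)
  then have p3: "(\<lambda>k. poisson l k * real k ^ 3) sums (l * (l * (l + 1) + 2 * l + 1))"
    using poisson_sums_shift[of l "\<lambda>k. real k ^ 2" "l * (l + 1) + 2 * l + 1"]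
    by (simp add: algebra_simps power2_eq_square power3_eq_cube)
  have "(\<lambda>k. poisson l k * real k ^ 3 + 3 * (poisson l k * real k ^ 2)
             + 3 * (poisson l k * real k) + poisson l k)
          sums (l * (l * (l + 1) + 2 * l + 1) + 3 * (l * (l + 1)) + 3 * l + 1)" (is "_ sums ?s")
    by (intro sums_add sums_mult p0 p1 p2 p3)
  then have p4: "(\<lambda>k. poisson l k * real k ^ 4) sums (l * ?s)"
    using poisson_sums_shift[of l "\<lambda>k. real k ^ 3" ?s]
    by (simp add: algebra_simps power2_eq_square power3_eq_cube power4_eq_xxxx)
  have "(\<lambda>k. poisson l k * real k - l * poisson l k) sums (l - l * 1)"
    by (intro sums_diff sums_mult p0 p1)
  then show "(\<lambda>k. poisson l k * (real k - l)) sums 0" by (simp add: algebra_simps)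
  have "(\<lambda>k. poisson l k * real k ^ 2 - 2 * l * (poisson l k * real k) + l^2 * poisson l k)
          sums (l * (l + 1) - 2 * l * l + l^2 * 1)"
    by (intro sums_add sums_diff sums_mult p0 p1 p2)
  then show "(\<lambda>k. poisson l k * (real k - l)^2) sums l"
    by (simp add: algebra_simps power2_eq_square)
  have "(\<lambda>k. poisson l k * real k ^ 4 - 4 * l * (poisson l k * real k ^ 3)
            + 6 * l^2 * (poisson l k * real k ^ 2) - 4 * l^3 * (poisson l k * real k)
            + l^4 * poisson l k)
          sums (l * ?s - 4 * l * (l * (l * (l + 1) + 2 * l + 1))
            + 6 * l^2 * (l * (l + 1)) - 4 * l^3 * l + l^4 * 1)"
    by (intro sums_add sums_diff sums_mult p0 p1 p2 p3 p4)
  then show "(\<lambda>k. poisson l k * (real k - l)^4) sums (3 * l^2 + l)"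
    by (simp add: algebra_simps power2_eq_square power3_eq_cube power4_eq_xxxx)
qed

lemma szasz_moments:
  assumes "n \<ge> 1"
  shows "(\<lambda>k. poisson (real n * x) k * (real k / real n - x)) sums 0"
    and "(\<lambda>k. poisson (real n * x) k * (real k / real n - x)^2) sums (x / n)"
    and "(\<lambda>k. poisson (real n * x) k * (real k / real n - x)^4) sums (3 * x^2 / real n^2 + x / real n^3)"
proof -
  have e: "real k / real n - x = (real k - real n * x) / real n" for k
    using assms by (simp add: field_simps)
  show "(\<lambda>k. poisson (real n * x) k * (real k / real n - x)) sums 0"
    using sums_divide[OF poisson_moments(1)[of "real n * x"], of "real n"] by (simp add: e)
  have "real n * x / real n ^ 2 = x / n" using assms by (simp add: field_simps power2_eq_square)
  then show "(\<lambda>k. poisson (real n * x) k * (real k / real n - x)^2) sums (x / n)"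
    using sums_divide[OF poisson_moments(2)[of "real n * x"], of "real n ^ 2"]
    by (simp add: e power_divide)
  have "(3 * (real n * x)^2 + real n * x) / real n ^ 4 = 3 * x^2 / real n^2 + x / real n^3"
    using assms by (simp add: field_simps power2_eq_square power3_eq_cube power4_eq_xxxx)
  then show "(\<lambda>k. poisson (real n * x) k * (real k / real n - x)^4) sums (3 * x^2 / real n^2 + x / real n^3)"
    using sums_divide[OF poisson_moments(3)[of "real n * x"], of "real n ^ 4"]
    by (simp add: e power_divide)
qed

section \<open>The Voronovskaya error as an average of Taylor remainders\<close>

definition taylor2_rem :: "(real \<Rightarrow> real) \<Rightarrow> real \<Rightarrow> real \<Rightarrow> real" where
  "taylor2_rem f x t =
     f t - f x - deriv0 f x * (t - x) - (deriv0 ^^ 2) f x / 2 * (t - x)^2"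

text \<open>
  The term \<^term>\<open>A_op f x\<close> is exactly what the quadratic Taylor term contributes, so that only the
  remainder is left to average. Boundedness of \<open>f\<close> serves to make the series of the operator converge.
\<close>

lemma szasz_error_bound:
  assumes "n \<ge> 1" and x: "x \<ge> 0"
    and bdd: "\<And>t. t \<ge> 0 \<Longrightarrow> \<bar>f t\<bar> \<le> B"
    and rem: "\<And>t. t \<ge> 0 \<Longrightarrow> \<bar>taylor2_rem f x t\<bar> \<le> c + a * (t - x)^2 + b * (t - x)^4"
  shows "\<bar>real n * (szasz n f x - f x) - A_op f x\<bar>
           \<le> n * c + a * x + b * (3 * x^2 + x / n) / n"
proof -
  define p where "p = poisson (real n * x)"
  have p0: "p k \<ge> 0" for k using x by (simp add: p_def poisson_nonneg)
  have p_sum: "p sums 1" by (simp add: p_def poisson_sums_1)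
  have "summable (\<lambda>k. p k * f (real k / real n))"
  proof (rule summable_comparison_test)
    show "\<exists>N. \<forall>k\<ge>N. norm (p k * f (real k / real n)) \<le> p k * B"
      using p0 bdd by (auto simp: abs_mult intro!: mult_left_mono)
    show "summable (\<lambda>k. p k * B)" using p_sum by (intro summable_mult2) (rule sums_summable)
  qed
  then have f_sum: "(\<lambda>k. p k * f (real k / real n)) sums szasz n f x"
    by (simp add: szasz_def p_def poisson_def summable_sums)
  note m = szasz_moments[OF assms(1), of x, folded p_def]
  define v where "v = szasz n f x - f x * 1 - deriv0 f x * 0 - (deriv0 ^^ 2) f x / 2 * (x / n)"
  have "(\<lambda>k. p k * f (real k / real n) - f x * p k - deriv0 f x * (p k * (real k / real n - x))
          - (deriv0 ^^ 2) f x / 2 * (p k * (real k / real n - x)^2)) sums v"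
    unfolding v_def by (intro sums_diff sums_mult f_sum p_sum m)
  moreover have "(\<lambda>k. p k * f (real k / real n) - f x * p k
        - deriv0 f x * (p k * (real k / real n - x))
        - (deriv0 ^^ 2) f x / 2 * (p k * (real k / real n - x)^2))
      = (\<lambda>k. p k * taylor2_rem f x (real k / real n))"
    by (auto simp: taylor2_rem_def algebra_simps)
  ultimately have rem_sum: "(\<lambda>k. p k * taylor2_rem f x (real k / real n)) sums v" by simp
  define w where "w = c * 1 + a * (x / n) + b * (3 * x^2 / real n^2 + x / real n^3)"
  have "(\<lambda>k. c * p k + a * (p k * (real k / real n - x)^2) + b * (p k * (real k / real n - x)^4))
          sums w"
    unfolding w_def by (intro sums_add sums_mult p_sum m)
  moreover have "(\<lambda>k. c * p k + a * (p k * (real k / real n - x)^2)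
        + b * (p k * (real k / real n - x)^4))
      = (\<lambda>k. p k * (c + a * (real k / real n - x)^2 + b * (real k / real n - x)^4))"
    by (auto simp: algebra_simps)
  ultimately have bound_sum:
    "(\<lambda>k. p k * (c + a * (real k / real n - x)^2 + b * (real k / real n - x)^4)) sums w" by simp
  have termwise: "\<bar>p k * taylor2_rem f x (real k / real n)\<bar>
        \<le> p k * (c + a * (real k / real n - x)^2 + b * (real k / real n - x)^4)" for k
    using p0[of k] rem[of "real k / real n"] by (auto simp: abs_mult intro!: mult_left_mono)
  have "v \<le> w" by (rule sums_le[OF _ rem_sum bound_sum]) (use termwise in \<open>simp add: abs_le_iff\<close>)
  moreover have "- v \<le> w"
    by (rule sums_le[OF _ sums_minus[OF rem_sum] bound_sum]) (use termwise in \<open>simp add: abs_le_iff\<close>)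
  ultimately have "real n * \<bar>v\<bar> \<le> real n * w" by (intro mult_left_mono) auto
  moreover have "real n * v = real n * (szasz n f x - f x) - A_op f x"
    using assms(1,2) by (auto simp: v_def A_op_def field_simps)
  moreover have "real n * w = n * c + a * x + b * (3 * x^2 + x / n) / n"
    using assms(1) by (simp add: w_def field_simps power2_eq_square power3_eq_cube)
  ultimately show ?thesis by (metis abs_mult abs_of_nat)
qed

section \<open>Taylor remainders on the half-line\<close>

lemma C_r_2_derivatives:
  assumes "f \<in> C_r 2" "x \<ge> 0"
  shows "(f has_vector_derivative deriv0 f x) (at x within {0..})"
    and "(deriv0 f has_vector_derivative (deriv0 ^^ 2) f x) (at x within {0..})"
proof -
  have d: "(deriv0 ^^ k) f differentiable_on {0..}" if "k < 2" for k
    using assms(1) that by (simp add: C_r_def)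
  then have "f differentiable (at x within {0..})" "deriv0 f differentiable (at x within {0..})"
    using d[of 0] d[of 1] assms(2) by (auto simp: differentiable_on_def)
  then show "(f has_vector_derivative deriv0 f x) (at x within {0..})"
    and "(deriv0 f has_vector_derivative (deriv0 ^^ 2) f x) (at x within {0..})"
    by (auto simp: vector_derivative_works deriv0_def numeral_2_eq_2)
qed

text \<open>
  Restricting \<open>f\<close> to the segment from \<open>x\<close> to \<open>t\<close>, parametrised by \<open>[0, 1]\<close>, gives
  \<open>R(t) = (t - x)\<^sup>2 \<integral> (1 - s) (f''(x + s (t - x)) - f''(x)) ds\<close>. The parametrisation treats \<open>t < x\<close> and
  \<open>t > x\<close> alike and stays in \<open>{0..}\<close>, where the one-sided derivative at \<open>0\<close> suffices. The affine
  majorant covers both bounded oscillation (\<open>d = 0\<close>) and a Lipschitz \<open>f''\<close> (\<open>c = 0\<close>).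
\<close>

lemma taylor2_rem_bound:
  assumes f: "f \<in> C_r 2" and x: "x \<ge> 0" and t: "t \<ge> 0"
    and osc: "\<And>s. 0 \<le> s \<Longrightarrow> s \<le> 1 \<Longrightarrow>
        \<bar>(deriv0 ^^ 2) f (x + s * (t - x)) - (deriv0 ^^ 2) f x\<bar> \<le> c + d * s"
  shows "\<bar>taylor2_rem f x t\<bar> \<le> (t - x)^2 * (c / 2 + d / 6)"
proof -
  define y where "y s = x + s * (t - x)" for s
  define D where "D = (\<lambda>i::nat. if i = 0 then (\<lambda>s. f (y s))
      else if i = 1 then (\<lambda>s. (t - x) * deriv0 f (y s))
      else (\<lambda>s. (t - x)^2 * (deriv0 ^^ 2) f (y s)))"
  have y0: "y s \<ge> 0" if "0 \<le> s" "s \<le> 1" for s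
  proof -
    have "y s = (1 - s) * x + s * t" by (simp add: y_def algebra_simps)
    then show ?thesis using that x t by simp
  qed
  have yd: "(y has_vector_derivative (t - x)) (at s within {0..1})" for s
    unfolding y_def has_real_derivative_iff_has_vector_derivative[symmetric]
    by (auto intro!: derivative_eq_intros)
  have chain: "((\<lambda>s. g (y s)) has_vector_derivative ((t - x) * g')) (at s within {0..1})"
    if "(g has_vector_derivative g') (at (y s) within {0..})" "0 \<le> s" "s \<le> 1" for g g' s
  proof -
    have "(g has_vector_derivative g') (at (y s) within y ` {0..1})"
      by (rule has_vector_derivative_within_subset[OF that(1)]) (use y0 in auto)
    from vector_diff_chain_within[OF yd this] show ?thesis by (simp add: o_def)
  qed
  have deriv: "(D m has_vector_derivative D (Suc m) s) (at s within {0..1})"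
    if "m < 2" "0 \<le> s" "s \<le> 1" for m s
  proof (cases "m = 0")
    case True
    then show ?thesis
      using chain[OF C_r_2_derivatives(1)[OF f y0]] that by (simp add: D_def)
  next
    case False
    then have "m = 1" using that by simp
    then show ?thesis
      using has_vector_derivative_mult_right[OF chain[OF C_r_2_derivatives(2)[OF f y0]], of s "t - x"] that
      by (simp add: D_def power2_eq_square mult.assoc)
  qed
  have "((\<lambda>s. ((1 - s) ^ (2 - 1) / fact (2 - 1)) *\<^sub>R D 2 s) has_integral
      D 0 1 - (\<Sum>i<2. ((1 - 0) ^ i / fact i) *\<^sub>R D i 0)) {0..1}"
    by (rule Taylor_has_integral) (use deriv in auto)
  then have I: "((\<lambda>s. (1 - s) * ((t - x)^2 * (deriv0 ^^ 2) f (y s))) has_integral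
      f t - f x - deriv0 f x * (t - x)) {0..1}"
    by (simp add: D_def y_def numeral_2_eq_2 algebra_simps)
  have prim: "((\<lambda>s. (1 - s) * (c + d * s)) has_integral (c / 2 + d / 6)) {0..1::real}" for c d :: real
  proof -
    have "((\<lambda>s. (1 - s) * (c + d * s)) has_integral
        (c * 1 + (d - c) * 1^2 / 2 - d * 1^3 / 3) - (c * 0 + (d - c) * 0^2 / 2 - d * 0^3 / 3)) {0..1::real}"
      unfolding has_real_derivative_iff_has_vector_derivative[symmetric]
      by (rule fundamental_theorem_of_calculus)
        (auto simp: has_real_derivative_iff_has_vector_derivative[symmetric] field_simps power2_eq_square
          intro!: derivative_eq_intros)
    then show ?thesis by (simp add: field_simps)
  qed
  have J: "((\<lambda>s. (1 - s) * ((t - x)^2 * (deriv0 ^^ 2) f (y s))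
        - (t - x)^2 * (deriv0 ^^ 2) f x * ((1 - s) * (1 + 0 * s)))
      has_integral taylor2_rem f x t) {0..1}"
    using has_integral_diff[OF I has_integral_mult_right[OF prim[of 1 0], of "(t - x)^2 * (deriv0 ^^ 2) f x"]]
    by (simp add: taylor2_rem_def algebra_simps)
  have K: "((\<lambda>s. (t - x)^2 * ((1 - s) * (c + d * s))) has_integral (t - x)^2 * (c / 2 + d / 6)) {0..1}"
    by (intro has_integral_mult_right prim)
  have pointwise: "\<bar>(1 - s) * ((t - x)^2 * (deriv0 ^^ 2) f (y s))
        - (t - x)^2 * (deriv0 ^^ 2) f x * ((1 - s) * (1 + 0 * s))\<bar>
      \<le> (t - x)^2 * ((1 - s) * (c + d * s))" if "s \<in> {0..1}" for s
  proof -
    have "(1 - s) * ((t - x)^2 * (deriv0 ^^ 2) f (y s))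
          - (t - x)^2 * (deriv0 ^^ 2) f x * ((1 - s) * (1 + 0 * s))
        = (t - x)^2 * ((1 - s) * ((deriv0 ^^ 2) f (y s) - (deriv0 ^^ 2) f x))"
      by (simp add: algebra_simps)
    moreover have "\<bar>\<dots>\<bar> \<le> (t - x)^2 * ((1 - s) * (c + d * s))"
      using osc[of s] that by (auto simp: abs_mult y_def intro!: mult_left_mono)
    ultimately show ?thesis by simp
  qed
  have "taylor2_rem f x t \<le> (t - x)^2 * (c / 2 + d / 6)"
    by (rule has_integral_le[OF J K]) (use pointwise in \<open>simp add: abs_le_iff\<close>)
  moreover have "- taylor2_rem f x t \<le> (t - x)^2 * (c / 2 + d / 6)"
    by (rule has_integral_le[OF has_integral_neg[OF J] K]) (use pointwise in \<open>simp add: abs_le_iff\<close>)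
  ultimately show ?thesis by simp
qed

section \<open>Lipschitz constants, bounds and weights\<close>

lemma Lip_const_bound:
  assumes "g \<in> Lip" "x \<ge> 0" "y \<ge> 0"
  shows "\<bar>g x - g y\<bar> \<le> Lip_const g * \<bar>x - y\<bar>"
proof (cases "x = y")
  case False
  obtain L where L: "L-lipschitz_on {0..} g" using assms(1) by (auto simp: Lip_def)
  let ?S = "{(x, y). 0 \<le> x \<and> 0 \<le> y \<and> x \<noteq> (y::real)}"
  have "\<bar>g u - g v\<bar> / \<bar>u - v\<bar> \<le> L" if "(u, v) \<in> ?S" for u v
    using lipschitz_onD[OF L, of u v] that by (auto simp: dist_real_def field_simps)
  then have "bdd_above ((\<lambda>(x, y). \<bar>g x - g y\<bar> / \<bar>x - y\<bar>) ` ?S)"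
    by (intro bdd_aboveI[of _ L]) auto
  then have "(\<lambda>(x, y). \<bar>g x - g y\<bar> / \<bar>x - y\<bar>) (x, y) \<le> Lip_const g"
    unfolding Lip_const_def by (rule cSUP_upper[rotated]) (use assms False in auto)
  then show ?thesis using False by (simp add: field_simps)
qed simp

lemma Lip_const_nonneg: "g \<in> Lip \<Longrightarrow> Lip_const g \<ge> 0"
  using order_trans[OF abs_ge_zero Lip_const_bound[of g 0 1]] by simp

lemma C_inf_bounded:
  assumes "f \<in> C_inf"
  obtains B where "\<And>t. t \<ge> 0 \<Longrightarrow> \<bar>f t\<bar> \<le> B"
proof -
  have "eventually (\<lambda>t. \<bar>f t\<bar> < 1) at_top"
    using assms order_tendstoD(2)[OF tendsto_rabs, of f 0 at_top 1] by (simp add: C_inf_def)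
  then obtain N where N: "\<And>t. t \<ge> N \<Longrightarrow> \<bar>f t\<bar> < 1"
    unfolding eventually_at_top_linorder by blast
  have "continuous_on {0..} f" using assms by (simp add: C_inf_def)
  then have "continuous_on {0..N} f" by (rule continuous_on_subset) auto
  then have "compact (f ` {0..N})" by (intro compact_continuous_image compact_Icc)
  then obtain b where "\<forall>y\<in>f ` {0..N}. norm y \<le> b"
    using compact_imp_bounded bounded_iff by metis
  then have b: "\<bar>f t\<bar> \<le> b" if "t \<in> {0..N}" for t using that by simp
  show thesis
  proof (rule that[of "max 1 b"])
    show "\<bar>f t\<bar> \<le> max 1 b" if "t \<ge> 0" for t
      using N[of t] b[of t] that by (cases "t \<ge> N") auto
  qed
qed

lemma weight_bounds:
  assumes "x \<ge> 0"
  shows "weight \<alpha> x > 0" "weight \<alpha> x \<le> 1" "weight \<alpha> x * (1 + x powr \<alpha>) = 1"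
proof -
  have "x powr \<alpha> \<ge> 0" by simp
  then have "1 + x powr \<alpha> > 0" by linarith
  then show "weight \<alpha> x > 0" "weight \<alpha> x \<le> 1" "weight \<alpha> x * (1 + x powr \<alpha>) = 1"
    unfolding weight_def by (auto simp: field_simps)
qed

lemma weight_le_inverse_linear:
  assumes "\<alpha> \<ge> 1" "x \<ge> 0"
  shows "weight \<alpha> x \<le> 2 / (1 + x)"
proof -
  have "x \<le> 1 + x powr \<alpha>"
  proof (cases "x \<ge> 1")
    case True
    then have "x powr 1 \<le> x powr \<alpha>" using assms by (intro powr_mono) auto
    then show ?thesis using True by simp
  qed (use assms in \<open>simp add: add_increasing2\<close>)
  moreover have "x powr \<alpha> \<ge> 0" by simp
  ultimately have "1 + x \<le> 2 * (1 + x powr \<alpha>)" unfolding distrib_left by linarith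
  then show ?thesis using assms by (simp add: weight_def field_simps add_pos_nonneg)
qed

text \<open>
  The right-hand side is the maximum of the left-hand side over \<open>x \<ge> 0\<close>, attained where
  \<open>x powr \<alpha> = \<beta> / (\<alpha> - \<beta>)\<close>. With \<open>\<theta> = \<beta> / \<alpha>\<close> and \<open>y = x powr \<alpha>\<close> it is the weighted
  arithmetic-geometric mean inequality for \<open>y / \<theta>\<close> and \<open>1 / (1 - \<theta>)\<close>, which are equal exactly there.
\<close>

lemma weight_powr_le:
  assumes "0 < \<beta>" "\<beta> < \<alpha>" "x \<ge> 0"
  shows "weight \<alpha> x * x powr \<beta> \<le> (\<alpha> - \<beta>) / \<alpha> * (\<beta> / (\<alpha> - \<beta>)) powr (\<beta> / \<alpha>)"
proof (cases "x = 0")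
  case False
  define \<theta> where "\<theta> = \<beta> / \<alpha>"
  have \<theta>: "0 < \<theta>" "\<theta> < 1" using assms by (auto simp: \<theta>_def)
  define y where "y = x powr \<alpha>"
  have y: "y > 0" using False by (simp add: y_def)
  have "(y / \<theta>) powr \<theta> * (1 / (1 - \<theta>)) powr (1 - \<theta>) \<le> \<theta> * (y / \<theta>) + (1 - \<theta>) * (1 / (1 - \<theta>))"
    using \<theta> y by (intro Youngs_inequality_0) auto
  then have le: "(y / \<theta>) powr \<theta> * (1 / (1 - \<theta>)) powr (1 - \<theta>) \<le> 1 + y"
    using \<theta> by simp
  have "x powr \<beta> = y powr \<theta>" using assms by (simp add: y_def \<theta>_def powr_powr)
  also have "\<dots> = (1 - \<theta>) * (\<theta> / (1 - \<theta>)) powr \<theta> * ((y / \<theta>) powr \<theta> * (1 / (1 - \<theta>)) powr (1 - \<theta>))"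
    using \<theta> y by (simp add: powr_divide powr_diff field_simps)
  also have "\<dots> \<le> (1 - \<theta>) * (\<theta> / (1 - \<theta>)) powr \<theta> * (1 + y)"
    using \<theta> by (intro mult_left_mono le) auto
  finally have "weight \<alpha> x * x powr \<beta>
      \<le> weight \<alpha> x * ((1 - \<theta>) * (\<theta> / (1 - \<theta>)) powr \<theta> * (1 + y))"
    using weight_bounds(1)[OF assms(3), of \<alpha>] by (intro mult_left_mono) auto
  also have "\<dots> = (1 - \<theta>) * (\<theta> / (1 - \<theta>)) powr \<theta>"
    using weight_bounds(3)[OF assms(3), of \<alpha>] by (simp add: y_def mult.left_commute)
  also have "1 - \<theta> = (\<alpha> - \<beta>) / \<alpha>" using assms by (simp add: \<theta>_def field_simps)
  also have "\<theta> / ((\<alpha> - \<beta>) / \<alpha>) = \<beta> / (\<alpha> - \<beta>)" using assms by (simp add: \<theta>_def)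
  finally show ?thesis by (simp add: \<theta>_def)
qed (use assms in simp)

text \<open>
  The fractions \<open>a / (a + b)\<close> and \<open>b / (a + b)\<close> add up to \<open>1\<close>, and a power \<open>p \<le> 1\<close> does not
  decrease numbers in \<open>[0, 1]\<close>.
\<close>

lemma powr_subadditive:
  fixes a b p :: real
  assumes "a \<ge> 0" "b \<ge> 0" "0 < p" "p \<le> 1"
  shows "(a + b) powr p \<le> a powr p + b powr p"
proof (cases "a + b = 0")
  case False
  then have s: "a + b > 0" using assms by simp
  have "u \<le> u powr p" if "0 \<le> u" "u \<le> 1" for u :: real
    using powr_mono'[of p 1 u] that assms by simp
  then have "a / (a + b) \<le> (a / (a + b)) powr p" "b / (a + b) \<le> (b / (a + b)) powr p"
    using assms s by auto
  moreover have "a / (a + b) + b / (a + b) = 1" using s by (simp flip: add_divide_distrib)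
  ultimately have "1 \<le> (a powr p + b powr p) / (a + b) powr p"
    using assms s by (simp add: powr_divide add_divide_distrib)
  then show ?thesis using s by (simp add: field_simps)
qed (use assms in auto)

section \<open>The quantitative estimate for Lipschitz second derivatives\<close>

text \<open>
  The two terms of the fourth moment, raised to the power \<open>3/4\<close> separately, scale like \<open>n powr (-3/2)\<close>
  and \<open>n powr (-9/4)\<close>; multiplied by \<open>n\<close>, both are at most of order \<open>1 / sqrt n\<close>.
\<close>

lemma szasz_fourth_moment_powr:
  assumes "n \<ge> 1" "x \<ge> 0"
  shows "real n * (3 * x^2 / real n^2 + x / real n^3) powr (3/4)
      \<le> (3 powr (3/4) * x powr (3/2) + x powr (3/4)) / sqrt n"
proof (cases "x = 0")
  case False
  then have x: "x > 0" using assms by simp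
  have n: "real n \<ge> 1" using assms by simp
  have "real n * (3 * x^2 / real n^2 + x / real n^3) powr (3/4)
      \<le> real n * ((3 * x^2 / real n^2) powr (3/4) + (x / real n^3) powr (3/4))"
    using x n by (intro mult_left_mono powr_subadditive) auto
  also have "\<dots> = 3 powr (3/4) * x powr (3/2) * (real n powr 1 * real n powr (-3/2))
      + x powr (3/4) * (real n powr 1 * real n powr (-9/4))"
  proof -
    have "3 * x^2 / real n^2 = 3 * (x powr 2 * real n powr (-2))" "x / real n^3 = x * real n powr (-3)"
      using x n by (simp_all add: powr_minus divide_inverse powr_numeral)
    moreover have "(3 * (x powr 2 * real n powr (-2))) powr (3/4)
        = 3 powr (3/4) * (x powr (3/2) * real n powr (-3/2))"
      using x n by (simp add: powr_mult powr_powr del: powr_numeral)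
    moreover have "(x * real n powr (-3)) powr (3/4) = x powr (3/4) * real n powr (-9/4)"
      using x n by (simp add: powr_mult powr_powr del: powr_numeral)
    ultimately show ?thesis using n by (simp only: powr_one) (simp add: algebra_simps)
  qed
  also have "\<dots> = 3 powr (3/4) * x powr (3/2) * real n powr (-1/2) + x powr (3/4) * real n powr (-5/4)"
    unfolding powr_add[symmetric] by simp
  also have "\<dots> \<le> 3 powr (3/4) * x powr (3/2) * real n powr (-1/2) + x powr (3/4) * real n powr (-1/2)"
    using n by (intro add_left_mono mult_left_mono powr_mono) auto
  also have "\<dots> = (3 powr (3/4) * x powr (3/2) + x powr (3/4)) / sqrt n"
    using n by (simp add: powr_minus powr_half_sqrt field_simps)
  finally show ?thesis .
qed simp

text \<open>
  The third absolute moment is estimated by Young's inequality \<open>u^3 \<le> l^3 / 4 + 3 u^4 / (4 l)\<close>, which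
  fits the form that \<open>szasz_error_bound\<close> accepts. Taking \<open>l\<close> to be the fourth root of the fourth
  moment \<open>m\<close> makes the average of the right-hand side equal to \<open>m powr (3/4)\<close>, the bound that
  Hoelder's inequality would give.
\<close>

lemma weighted_error_bound_Lip:
  assumes \<alpha>: "\<alpha> > 3/2" and f: "f \<in> C_inf_r 2" and Lip: "(deriv0 ^^ 2) f \<in> Lip"
    and n: "n \<ge> 1" and x: "x \<ge> 0"
  shows "\<bar>weight \<alpha> x * (real n * (szasz n f x - f x) - A_op f x)\<bar>
      \<le> 1 / (6 * sqrt n) * M_const \<alpha> * Lip_const ((deriv0 ^^ 2) f)"
proof -
  define L where "L = Lip_const ((deriv0 ^^ 2) f)"
  have L: "L \<ge> 0" using Lip by (simp add: L_def Lip_const_nonneg)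
  have f': "f \<in> C_inf" "f \<in> C_r 2" using f by (auto simp: C_inf_r_def)
  obtain B where B: "\<And>t. t \<ge> 0 \<Longrightarrow> \<bar>f t\<bar> \<le> B" using C_inf_bounded[OF f'(1)] by blast
  define m where "m = 3 * x^2 / real n^2 + x / real n^3"
  have rem: "\<bar>taylor2_rem f x t\<bar> \<le> L / 6 * \<bar>t - x\<bar> ^ 3" if t: "t \<ge> 0" for t
  proof -
    have "\<bar>taylor2_rem f x t\<bar> \<le> (t - x)^2 * (0 / 2 + (L * \<bar>t - x\<bar>) / 6)"
    proof (rule taylor2_rem_bound[OF f'(2) x t])
      fix s :: real assume s: "0 \<le> s" "s \<le> 1"
      have "x + s * (t - x) = (1 - s) * x + s * t" by (simp add: algebra_simps)
      then have "x + s * (t - x) \<ge> 0" using s x t by simp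
      from Lip_const_bound[OF Lip this x]
      show "\<bar>(deriv0 ^^ 2) f (x + s * (t - x)) - (deriv0 ^^ 2) f x\<bar> \<le> 0 + L * \<bar>t - x\<bar> * s"
        using s by (simp add: L_def abs_mult mult_ac)
    qed
    also have "\<dots> = L / 6 * (\<bar>t - x\<bar>^2 * \<bar>t - x\<bar>)" by simp
    also have "\<bar>t - x\<bar>^2 * \<bar>t - x\<bar> = \<bar>t - x\<bar> ^ 3"
      by (simp only: power2_eq_square power3_eq_cube)
    finally show ?thesis .
  qed
  have main: "\<bar>real n * (szasz n f x - f x) - A_op f x\<bar> \<le> L / 6 * (real n * m powr (3/4))"
    \<comment> \<open>At \<open>0\<close> the operator interpolates; there \<open>m = 0\<close>, so that Young's inequality has no usable \<open>l\<close>.\<close>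
  proof (cases "x = 0")
    case True
    have "(\<lambda>k. exp (- (real n * x)) * (real n * x) ^ k / fact k * f (real k / real n))
        = (\<lambda>k. if k = 0 then f 0 else 0)" using True by auto
    then have "szasz n f x = f x"
      using True sums_unique[OF sums_single[of 0 "\<lambda>_. f 0"]] by (simp add: szasz_def)
    then show ?thesis using True L by (simp add: A_op_def)
  next
    case False
    then have m: "m > 0" using x n by (auto simp: m_def intro!: add_pos_pos divide_pos_pos)
    define l where "l = m powr (1/4)"
    have l: "l > 0" using m by (simp add: l_def)
    have l34: "l ^ 3 = m powr (3/4)" "l ^ 4 = m"
      using m by (simp_all add: l_def powr_powr flip: powr_numeral)
    have young: "u ^ 3 \<le> l^3 / 4 + 3 / (4 * l) * u ^ 4" for u :: real
    proof -
      have "l ^ 4 + 3 * u ^ 4 - 4 * l * u ^ 3 = (u - l)^2 * (2 * u^2 + (u + l)^2)"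
        by (simp add: algebra_simps power2_eq_square power3_eq_cube power4_eq_xxxx)
      also have "\<dots> \<ge> 0" by (intro mult_nonneg_nonneg add_nonneg_nonneg) auto
      finally have "4 * l * u ^ 3 \<le> l ^ 4 + 3 * u ^ 4" by simp
      then show ?thesis using l by (simp add: field_simps power3_eq_cube power4_eq_xxxx)
    qed
    have "\<bar>real n * (szasz n f x - f x) - A_op f x\<bar>
        \<le> n * (L / 6 * (l^3 / 4)) + 0 * x + L / 6 * (3 / (4 * l)) * (3 * x^2 + x / n) / n"
    proof (rule szasz_error_bound[OF n x B])
      fix t :: real assume t: "t \<ge> 0"
      have "\<bar>taylor2_rem f x t\<bar> \<le> L / 6 * \<bar>t - x\<bar> ^ 3" by (rule rem[OF t])
      also have "\<dots> \<le> L / 6 * (l^3 / 4 + 3 / (4 * l) * \<bar>t - x\<bar> ^ 4)"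
        using L by (intro mult_left_mono young) auto
      also have "\<bar>t - x\<bar> ^ 4 = (t - x) ^ 4" by (rule power_even_abs) simp
      finally show "\<bar>taylor2_rem f x t\<bar>
          \<le> L / 6 * (l^3 / 4) + 0 * (t - x)^2 + L / 6 * (3 / (4 * l)) * (t - x)^4"
        by (simp add: algebra_simps)
    qed
    also have "(3 * x^2 + x / n) / n = n * m"
      using n by (simp add: m_def field_simps power2_eq_square power3_eq_cube)
    then have "L / 6 * (3 / (4 * l)) * (3 * x^2 + x / n) / n = L / 6 * (3 / (4 * l)) * (n * l ^ 4)"
      unfolding l34 by (metis times_divide_eq_right)
    also have "n * (L / 6 * (l^3 / 4)) + 0 * x + L / 6 * (3 / (4 * l)) * (n * l ^ 4)
        = L / 6 * (real n * l ^ 3)"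
      using l by (simp add: field_simps power3_eq_cube power4_eq_xxxx)
    finally show ?thesis by (simp add: l34)
  qed
  have w: "weight \<alpha> x > 0" using weight_bounds x by simp
  have "weight \<alpha> x * x powr (3/2) \<le> (2*\<alpha> - 3) / (2*\<alpha>) * (3 / (2*\<alpha> - 3)) powr (3 / (2*\<alpha>))"
  proof -
    have "(\<alpha> - 3/2) / \<alpha> = (2*\<alpha> - 3) / (2*\<alpha>)" "3/2 / (\<alpha> - 3/2) = 3 / (2*\<alpha> - 3)" "3/2 / \<alpha> = 3 / (2*\<alpha>)"
      using \<alpha> by (auto simp: field_simps)
    then show ?thesis using weight_powr_le[of "3/2" \<alpha> x] \<alpha> x by simp
  qed
  moreover have "weight \<alpha> x * x powr (3/4) \<le> (4*\<alpha> - 3) / (4*\<alpha>) * (3 / (4*\<alpha> - 3)) powr (3 / (4*\<alpha>))"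
  proof -
    have "(\<alpha> - 3/4) / \<alpha> = (4*\<alpha> - 3) / (4*\<alpha>)" "3/4 / (\<alpha> - 3/4) = 3 / (4*\<alpha> - 3)" "3/4 / \<alpha> = 3 / (4*\<alpha>)"
      using \<alpha> by (auto simp: field_simps)
    then show ?thesis using weight_powr_le[of "3/4" \<alpha> x] \<alpha> x by simp
  qed
  ultimately have M: "3 powr (3/4) * (weight \<alpha> x * x powr (3/2)) + weight \<alpha> x * x powr (3/4) \<le> M_const \<alpha>"
    unfolding M_const_def times_divide_eq_right[symmetric] mult.assoc
    by (intro add_mono mult_left_mono) (auto simp: mult.assoc)
  have "\<bar>weight \<alpha> x * (real n * (szasz n f x - f x) - A_op f x)\<bar>
      \<le> weight \<alpha> x * (L / 6 * (real n * m powr (3/4)))"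
    using main w by (simp add: abs_mult)
  also have "\<dots> \<le> weight \<alpha> x * (L / 6 * ((3 powr (3/4) * x powr (3/2) + x powr (3/4)) / sqrt n))"
    unfolding m_def using w L by (intro mult_left_mono szasz_fourth_moment_powr n x) auto
  also have "\<dots> = L / (6 * sqrt n)
      * (3 powr (3/4) * (weight \<alpha> x * x powr (3/2)) + weight \<alpha> x * x powr (3/4))"
    by (simp add: field_simps)
  also have "\<dots> \<le> L / (6 * sqrt n) * M_const \<alpha>" using L by (intro mult_left_mono M) auto
  also have "\<dots> = 1 / (6 * sqrt n) * M_const \<alpha> * L" by simp
  finally show ?thesis by (simp only: L_def)
qed

section \<open>Convergence on the operator domain\<close>

text \<open>
  Uniform continuity of \<open>f''\<close> handles \<open>|t - x| < \<delta>\<close>. For \<open>|t - x| \<ge> \<delta>\<close> every term of the remainder is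
  bounded by a multiple of \<open>(t - x)^4\<close>, since \<open>f'\<close> and \<open>f''\<close> are bounded on \<open>{0..R}\<close>; the factor
  \<open>1 + R\<^sup>2\<close> in the constant pays for the denominator \<open>1 + x\<^sup>2\<close>.
\<close>

lemma weighted_rem_bound_near:
  assumes \<alpha>: "\<alpha> \<ge> 1" and f: "f \<in> C_inf_r 2" and R: "R \<ge> 0" and \<epsilon>: "\<epsilon> > 0"
  obtains C where "C \<ge> 0"
    "\<And>x t. 0 \<le> x \<Longrightarrow> x \<le> R \<Longrightarrow> t \<ge> 0 \<Longrightarrow>
       weight \<alpha> x * \<bar>taylor2_rem f x t\<bar> \<le> \<epsilon> * (t - x)^2 / (1 + x) + C * (t - x)^4 / (1 + x^2)"
proof -
  let ?g = "(deriv0 ^^ 2) f"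
  have f': "f \<in> C_inf" "f \<in> C_r 2" using f by (auto simp: C_inf_r_def)
  obtain B where B: "\<And>t. t \<ge> 0 \<Longrightarrow> \<bar>f t\<bar> \<le> B" using C_inf_bounded[OF f'(1)] by blast
  have g: "continuous_on {0..} ?g" using f' by (simp add: C_r_def)
  have d: "continuous_on {0..} (deriv0 f)"
    using C_r_2_derivatives(2)[OF f'(2)]
    by (auto simp: continuous_on_eq_continuous_within intro: has_vector_derivative_continuous)
  have bounded: "\<exists>F\<ge>0. \<forall>x\<in>{0..R}. \<bar>h x\<bar> \<le> F" if "continuous_on {0..} h" for h :: "real \<Rightarrow> real"
  proof -
    have "continuous_on {0..R} h" using that by (rule continuous_on_subset) auto
    then have "compact (h ` {0..R})" by (intro compact_continuous_image compact_Icc)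
    then obtain F where "\<forall>y\<in>h ` {0..R}. norm y \<le> F" using compact_imp_bounded bounded_iff by metis
    then show ?thesis by (intro exI[of _ "max F 0"]) auto
  qed
  obtain F1 where F1: "F1 \<ge> 0" "\<forall>x\<in>{0..R}. \<bar>deriv0 f x\<bar> \<le> F1" using bounded[OF d] by blast
  obtain F2 where F2: "F2 \<ge> 0" "\<forall>x\<in>{0..R}. \<bar>?g x\<bar> \<le> F2" using bounded[OF g] by blast
  have "continuous_on {0..R+1} ?g" using g by (rule continuous_on_subset) auto
  then have "uniformly_continuous_on {0..R+1} ?g"
    by (rule compact_uniformly_continuous) (rule compact_Icc)
  then obtain \<delta>' where \<delta>': "\<delta>' > 0"
    "\<And>x y. x \<in> {0..R+1} \<Longrightarrow> y \<in> {0..R+1} \<Longrightarrow> \<bar>y - x\<bar> < \<delta>' \<Longrightarrow> \<bar>?g y - ?g x\<bar> < \<epsilon>"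
    unfolding uniformly_continuous_on_def dist_real_def using \<epsilon> by metis
  define \<delta> where "\<delta> = min \<delta>' 1"
  have \<delta>: "\<delta> > 0" "\<delta> \<le> \<delta>'" "\<delta> \<le> 1" using \<delta>' by (auto simp: \<delta>_def)
  define E where "E = 2 * B / \<delta>^4 + F1 / \<delta>^3 + F2 / \<delta>^2"
  have B0: "B \<ge> 0" using B[of 0] by simp
  have E: "E \<ge> 0" using B0 F1(1) F2(1) \<delta> by (simp add: E_def)
  show thesis
  proof (rule that[of "E * (1 + R^2)"])
    show "E * (1 + R^2) \<ge> 0" using E by simp
    fix x t :: real assume x: "0 \<le> x" "x \<le> R" and t: "t \<ge> 0"
    have w: "weight \<alpha> x > 0" "weight \<alpha> x \<le> 1" "weight \<alpha> x \<le> 2 / (1 + x)"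
      using weight_bounds x weight_le_inverse_linear \<alpha> by auto
    show "weight \<alpha> x * \<bar>taylor2_rem f x t\<bar>
        \<le> \<epsilon> * (t - x)^2 / (1 + x) + E * (1 + R^2) * (t - x)^4 / (1 + x^2)"
    proof (cases "\<bar>t - x\<bar> < \<delta>")
      case True
      have "\<bar>taylor2_rem f x t\<bar> \<le> (t - x)^2 * (\<epsilon> / 2 + 0 / 6)"
      proof (rule taylor2_rem_bound[OF f'(2) x(1) t])
        fix s :: real assume s: "0 \<le> s" "s \<le> 1"
        define y where "y = x + s * (t - x)"
        have "y = (1 - s) * x + s * t" by (simp add: y_def algebra_simps)
        then have "y \<ge> 0" using s x t by simp
        moreover have "\<bar>y - x\<bar> \<le> \<bar>t - x\<bar>" using s by (simp add: y_def abs_mult mult_left_le_one_le)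
        ultimately have "\<bar>?g y - ?g x\<bar> < \<epsilon>" using True \<delta> x by (intro \<delta>'(2)) auto
        then show "\<bar>?g (x + s * (t - x)) - ?g x\<bar> \<le> \<epsilon> + 0 * s" by (simp add: y_def)
      qed
      then have "weight \<alpha> x * \<bar>taylor2_rem f x t\<bar> \<le> 2 / (1 + x) * ((t - x)^2 * (\<epsilon> / 2))"
        using w x \<epsilon> by (intro mult_mono) auto
      also have "\<dots> = \<epsilon> * (t - x)^2 / (1 + x)" using x by (simp add: divide_simps)
      also have "\<dots> \<le> \<dots> + E * (1 + R^2) * (t - x)^4 / (1 + x^2)"
        using E by (simp add: add_nonneg_nonneg)
      finally show ?thesis .
    next
      case False
      define u where "u = \<bar>t - x\<bar>"
      have u: "u \<ge> \<delta>" "u > 0" using False \<delta> by (auto simp: u_def)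
      have u2: "(t - x)^2 = u^2" and u4: "(t - x)^4 = u^4" by (simp_all add: u_def)
      have "\<bar>deriv0 f x * (t - x)\<bar> \<le> F1 * u"
        using F1 x by (auto simp: abs_mult u_def intro!: mult_right_mono)
      moreover have "\<bar>?g x / 2 * (t - x)^2\<bar> \<le> F2 / 2 * u^2"
        using F2 x unfolding u2 abs_mult by (intro mult_mono) auto
      moreover have "F2 / 2 * u^2 \<le> F2 * u^2" using F2 by (intro mult_right_mono) auto
      ultimately have "\<bar>taylor2_rem f x t\<bar> \<le> 2 * B + F1 * u + F2 * u^2"
        using B[OF x(1)] B[OF t] unfolding taylor2_rem_def by linarith
      also have "\<dots> \<le> E * u^4"
      proof -
        have r: "1 \<le> (u / \<delta>) ^ k" for k using u \<delta> by (intro one_le_power) simp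
        have "2 * B * 1 \<le> 2 * B * (u / \<delta>)^4" using B0 by (intro mult_left_mono r) auto
        moreover have "F1 * u * 1 \<le> F1 * u * (u / \<delta>)^3" using F1 u by (intro mult_left_mono r) auto
        moreover have "F2 * u^2 * 1 \<le> F2 * u^2 * (u / \<delta>)^2" using F2 by (intro mult_left_mono r) auto
        moreover have "E * u^4 = 2 * B * (u / \<delta>)^4 + F1 * u * (u / \<delta>)^3 + F2 * u^2 * (u / \<delta>)^2"
          by (simp add: E_def power_divide distrib_right power2_eq_square power3_eq_cube power4_eq_xxxx)
        ultimately show ?thesis by linarith
      qed
      finally have "weight \<alpha> x * \<bar>taylor2_rem f x t\<bar> \<le> 1 * (E * u^4)"
        using w by (intro mult_mono) auto
      also have "\<dots> \<le> E * u^4 * ((1 + R^2) / (1 + x^2))"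
      proof -
        have "x^2 \<le> R^2" using x by (intro power_mono) auto
        then have "1 \<le> (1 + R^2) / (1 + x^2)" by (simp add: add_pos_nonneg)
        then have "E * u^4 * 1 \<le> E * u^4 * ((1 + R^2) / (1 + x^2))"
          using E by (intro mult_left_mono) auto
        then show ?thesis by (simp only: mult_1_left mult_1_right)
      qed
      also have "\<dots> = E * (1 + R^2) * (t - x)^4 / (1 + x^2)" by (simp add: u4)
      also have "\<dots> \<le> \<epsilon> * (t - x)^2 / (1 + x) + \<dots>" using \<epsilon> x by simp
      finally show ?thesis .
    qed
  qed
qed

text \<open>
  For \<open>x / 2 \<le> t \<le> 2 x\<close> the segment from \<open>x\<close> to \<open>t\<close> stays in a region where \<open>w\<^sub>\<alpha>(x) |f''|\<close> is at most
  \<open>H / x\<close>, which gives the quadratic term. Otherwise \<open>|t - x| \<ge> x / 2\<close>, and boundedness of \<open>f\<close> and of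
  \<open>w\<^sub>\<alpha> f'\<close> suffices. The bound on \<open>w\<^sub>\<alpha> f'\<close> is read off from the Taylor expansion at \<open>t = 2 x\<close>, in
  which every term except \<open>f'(x) x\<close> has already been estimated.
\<close>

lemma weighted_rem_bound_far:
  assumes \<alpha>: "\<alpha> \<ge> 1" and f: "f \<in> C_inf_r 2 \<inter> A_domain \<alpha>" and \<epsilon>: "\<epsilon> > 0"
  obtains R C where "R \<ge> 0" "C \<ge> 0"
    "\<And>x t. x \<ge> R \<Longrightarrow> t \<ge> 0 \<Longrightarrow>
       weight \<alpha> x * \<bar>taylor2_rem f x t\<bar> \<le> \<epsilon> * (t - x)^2 / (1 + x) + C * (t - x)^4 / (1 + x^2)"
proof -
  let ?g = "(deriv0 ^^ 2) f"
  have f': "f \<in> C_inf" "f \<in> C_r 2" using f by (auto simp: C_inf_r_def)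
  obtain B where B: "\<And>t. t \<ge> 0 \<Longrightarrow> \<bar>f t\<bar> \<le> B" using C_inf_bounded[OF f'(1)] by blast
  have B0: "B \<ge> 0" using B[of 0] by simp
  define H where "H = \<epsilon> / 2"
  \<comment> \<open>The divisor pays for passing from \<open>s\<close> to \<open>x\<close> with \<open>x / 2 \<le> s \<le> 2 x\<close>: a factor
    \<open>2 powr \<alpha>\<close> in the weight and a factor \<open>2\<close> in \<open>1 / s\<close>.\<close>
  define \<eta> where "\<eta> = H / (2 powr \<alpha> * 2)"
  have \<eta>: "\<eta> > 0" "H > 0" using \<epsilon> by (auto simp: \<eta>_def H_def)
  have "((\<lambda>x. weight \<alpha> x * (x * ?g x)) \<longlongrightarrow> 0) at_top" using f by (simp add: A_domain_def)
  from order_tendstoD(2)[OF tendsto_rabs[OF this], of \<eta>]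
  have "eventually (\<lambda>s. \<bar>weight \<alpha> s * (s * ?g s)\<bar> < \<eta>) at_top" using \<eta> by simp
  then obtain N where N: "\<And>s. s \<ge> N \<Longrightarrow> \<bar>weight \<alpha> s * (s * ?g s)\<bar> < \<eta>"
    unfolding eventually_at_top_linorder by blast
  define R where "R = 2 * max N 1"
  have growth: "weight \<alpha> x * \<bar>?g s\<bar> \<le> H / x" if x: "x \<ge> R" and s: "x / 2 \<le> s" "s \<le> 2 * x" for x s
  proof -
    have x1: "x \<ge> 2" "s \<ge> 1" "s \<ge> N" using x s by (auto simp: R_def)
    have ws: "weight \<alpha> s > 0" "weight \<alpha> x > 0" using weight_bounds x1 by auto
    have "weight \<alpha> s * (s * \<bar>?g s\<bar>) \<le> \<eta>"
      using N[of s] x1 ws by (simp add: abs_mult)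
    then have gs: "s * \<bar>?g s\<bar> \<le> \<eta> * (1 + s powr \<alpha>)"
      using x1 by (simp add: weight_def field_simps add_pos_nonneg)
    have "s powr \<alpha> \<le> (2 * x) powr \<alpha>" using s x1 \<alpha> by (intro powr_mono2) auto
    also have "\<dots> = 2 powr \<alpha> * x powr \<alpha>" using x1 by (simp add: powr_mult)
    finally have sp: "1 + s powr \<alpha> \<le> 2 powr \<alpha> * (1 + x powr \<alpha>)"
      using powr_mono[of 0 \<alpha> 2] \<alpha> by (simp add: algebra_simps)
    have "x * \<bar>?g s\<bar> \<le> 2 * (s * \<bar>?g s\<bar>)"
      using mult_right_mono[of x "2 * s" "\<bar>?g s\<bar>"] s by (simp add: mult.assoc)
    also have "\<dots> \<le> 2 * (\<eta> * (2 powr \<alpha> * (1 + x powr \<alpha>)))"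
      using gs mult_left_mono[OF sp, of \<eta>] \<eta> by linarith
    also have "\<dots> = H * (1 + x powr \<alpha>)" by (simp add: \<eta>_def)
    finally have "weight \<alpha> x * (x * \<bar>?g s\<bar>) \<le> weight \<alpha> x * (H * (1 + x powr \<alpha>))"
      using ws by (intro mult_left_mono) auto
    also have "\<dots> = H" using weight_bounds(3)[of x \<alpha>] x1 by (simp add: mult.left_commute)
    finally show ?thesis using x1 by (simp add: field_simps)
  qed
  have near: "weight \<alpha> x * \<bar>taylor2_rem f x t\<bar> \<le> H / x * (t - x)^2"
    if x: "x \<ge> R" and t: "x / 2 \<le> t" "t \<le> 2 * x" for x t
  proof -
    have x2: "x \<ge> 2" using x by (simp add: R_def)
    have w: "weight \<alpha> x > 0" using weight_bounds x2 by auto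
    define K where "K = H / x / weight \<alpha> x"
    have g: "\<bar>?g s\<bar> \<le> K" if "x / 2 \<le> s" "s \<le> 2 * x" for s
      using growth[OF x that] w unfolding K_def by (subst pos_le_divide_eq) (auto simp: mult.commute)
    have "\<bar>taylor2_rem f x t\<bar> \<le> (t - x)^2 * (2 * K / 2 + 0 / 6)"
    proof (rule taylor2_rem_bound[OF f'(2)])
      fix s :: real assume s: "0 \<le> s" "s \<le> 1"
      define y where "y = x + s * (t - x)"
      have y: "y = (1 - s) * x + s * t" by (simp add: y_def algebra_simps)
      have "(1 - s) * (x / 2) + s * (x / 2) \<le> y" "y \<le> (1 - s) * (2 * x) + s * (2 * x)"
        unfolding y using s x2 t by (intro add_mono mult_left_mono; simp)+
      moreover have "(1 - s) * c + s * c = c" for c :: real by (simp add: algebra_simps)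
      ultimately have "x / 2 \<le> y" "y \<le> 2 * x" by (simp_all only:)
      from g[OF this] g[of x] show "\<bar>?g (x + s * (t - x)) - ?g x\<bar> \<le> 2 * K + 0 * s"
        using x2 by (simp add: y_def)
    qed (use x2 t in auto)
    then have "weight \<alpha> x * \<bar>taylor2_rem f x t\<bar> \<le> weight \<alpha> x * ((t - x)^2 * K)"
      using w by (intro mult_left_mono) auto
    also have "\<dots> = H / x * (t - x)^2" using w by (simp add: K_def)
    finally show ?thesis .
  qed
  define C where "C = 24 * B + 16 * H"
  show thesis
  proof (rule that[of R C])
    show "R \<ge> 0" "C \<ge> 0" using B0 \<eta> by (auto simp: R_def C_def)
    fix x t :: real assume x: "x \<ge> R" and t: "t \<ge> 0"
    have x2: "x \<ge> 2" using x by (simp add: R_def)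
    have w: "weight \<alpha> x > 0" "weight \<alpha> x \<le> 1" using weight_bounds x2 by auto
    define u where "u = \<bar>t - x\<bar>"
    have u2: "(t - x)^2 = u^2" and u4: "(t - x)^4 = u^4" by (simp_all add: u_def)
    have Hx: "H / x * u^2 \<le> \<epsilon> * u^2 / (1 + x)"
    proof -
      have "H / x \<le> \<epsilon> / (1 + x)" using x2 \<epsilon> by (simp add: H_def field_simps)
      then show ?thesis using mult_right_mono[of "H / x" "\<epsilon> / (1 + x)" "u^2"] by simp
    qed
    show "weight \<alpha> x * \<bar>taylor2_rem f x t\<bar> \<le> \<epsilon> * (t - x)^2 / (1 + x) + C * (t - x)^4 / (1 + x^2)"
    proof (cases "x / 2 \<le> t \<and> t \<le> 2 * x")
      case True
      then have "weight \<alpha> x * \<bar>taylor2_rem f x t\<bar> \<le> \<epsilon> * u^2 / (1 + x)"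
        using near[OF x, of t] Hx by (simp add: u2)
      also have "\<dots> \<le> \<dots> + C * u^4 / (1 + x^2)" using \<open>C \<ge> 0\<close> by simp
      finally show ?thesis by (simp only: u2 u4)
    next
      case False
      then have u: "x / 2 \<le> u" using x2 by (auto simp: u_def)
      have gx: "weight \<alpha> x * \<bar>?g x\<bar> \<le> H / x" using growth[OF x, of x] x2 by simp
      have d: "weight \<alpha> x * \<bar>deriv0 f x\<bar> \<le> B + 2 * H"
      proof -
        have "\<bar>deriv0 f x * x\<bar> \<le> 2 * B + \<bar>?g x / 2 * x^2\<bar> + \<bar>taylor2_rem f x (2 * x)\<bar>"
          using B[of x] B[of "2 * x"] x2 by (simp add: taylor2_rem_def)
        then have "weight \<alpha> x * \<bar>deriv0 f x * x\<bar>
            \<le> weight \<alpha> x * (2 * B + \<bar>?g x / 2 * x^2\<bar> + \<bar>taylor2_rem f x (2 * x)\<bar>)"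
          using w by (intro mult_left_mono) auto
        also have "\<dots> = weight \<alpha> x * (2 * B) + weight \<alpha> x * \<bar>?g x\<bar> * (x^2 / 2)
            + weight \<alpha> x * \<bar>taylor2_rem f x (2 * x)\<bar>"
          by (simp add: algebra_simps abs_mult)
        also have "\<dots> \<le> 1 * (2 * B) + H / x * (x^2 / 2) + H / x * (2 * x - x)^2"
          using near[OF x, of "2 * x"] x2 w B0 gx by (intro add_mono mult_right_mono) auto
        also have "\<dots> = 2 * B + 3 / 2 * H * x" using x2 by (simp add: power2_eq_square)
        also have "\<dots> \<le> B * x + 2 * H * x"
          using mult_left_mono[of 2 x B] x2 B0 \<eta> by (intro add_mono mult_right_mono) auto
        finally have "weight \<alpha> x * \<bar>deriv0 f x\<bar> * x \<le> (B + 2 * H) * x"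
          using x2 by (simp add: abs_mult algebra_simps)
        then show ?thesis using x2 by simp
      qed
      have "\<bar>taylor2_rem f x t\<bar> \<le> 2 * B + \<bar>deriv0 f x * (t - x)\<bar> + \<bar>?g x / 2 * (t - x)^2\<bar>"
        using B[of x] B[OF t] x2 unfolding taylor2_rem_def by linarith
      also have "\<dots> = 2 * B + \<bar>deriv0 f x\<bar> * u + \<bar>?g x\<bar> * (u^2 / 2)"
        by (simp add: abs_mult u_def)
      finally have "weight \<alpha> x * \<bar>taylor2_rem f x t\<bar>
          \<le> weight \<alpha> x * (2 * B + \<bar>deriv0 f x\<bar> * u + \<bar>?g x\<bar> * (u^2 / 2))"
        using w by (intro mult_left_mono) auto
      also have "\<dots> = weight \<alpha> x * (2 * B) + weight \<alpha> x * \<bar>deriv0 f x\<bar> * u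
          + weight \<alpha> x * \<bar>?g x\<bar> * (u^2 / 2)"
        by (simp add: algebra_simps)
      also have "\<dots> \<le> 1 * (2 * B) + (B + 2 * H) * u + H / x * (u^2 / 2)"
        using w B0 d gx u x2 by (intro add_mono mult_right_mono) auto
      also have "\<dots> \<le> C * u^4 / (1 + x^2) + \<epsilon> * u^2 / (1 + x)"
      proof -
        have "H / x * (u^2 / 2) \<le> H / x * u^2" using x2 \<eta> by (intro mult_left_mono) auto
        moreover have "2 * B + (B + 2 * H) * u \<le> C * u^4 / (1 + x^2)"
        proof -
          have u1: "u \<ge> 1" using u x2 by simp
          have u3: "u \<le> u^3" using u1 power_increasing[of 1 3 u] by simp
          have "1 + x^2 \<le> 2 * x^2" using x2 power_mono[of 1 x 2] by simp
          also have "x^2 \<le> (2 * u)^2" using u x2 by (intro power_mono) auto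
          finally have x2u: "1 + x^2 \<le> 8 * u^2" by (simp add: power_mult_distrib)
          have "2 * B + (B + 2 * H) * u \<le> (3 * B + 2 * H) * u"
            using mult_left_mono[of 1 u "2 * B"] u1 B0 by (simp add: algebra_simps)
          also have "\<dots> \<le> (3 * B + 2 * H) * u^2"
            using B0 \<eta> u1 power_increasing[of 1 2 u] by (intro mult_left_mono) auto
          finally have "(2 * B + (B + 2 * H) * u) * (1 + x^2) \<le> ((3 * B + 2 * H) * u^2) * (8 * u^2)"
            using x2u B0 \<eta> by (intro mult_mono) auto
          also have "\<dots> \<le> C * u^4"
            using B0 \<eta> by (simp add: C_def algebra_simps power2_eq_square power4_eq_xxxx)
          finally show ?thesis by (simp add: field_simps add_pos_nonneg)
        qed
        ultimately show ?thesis using Hx by linarith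
      qed
      finally show ?thesis by (simp add: u2 u4)
    qed
  qed
qed

lemma weighted_rem_bound:
  assumes \<alpha>: "\<alpha> \<ge> 1" and f: "f \<in> C_inf_r 2 \<inter> A_domain \<alpha>" and \<epsilon>: "\<epsilon> > 0"
  obtains C where "C \<ge> 0"
    "\<And>x t. x \<ge> 0 \<Longrightarrow> t \<ge> 0 \<Longrightarrow>
       weight \<alpha> x * \<bar>taylor2_rem f x t\<bar> \<le> \<epsilon> * (t - x)^2 / (1 + x) + C * (t - x)^4 / (1 + x^2)"
proof -
  obtain R C1 where 1: "R \<ge> 0" "C1 \<ge> 0" "\<And>x t. x \<ge> R \<Longrightarrow> t \<ge> 0 \<Longrightarrow>
      weight \<alpha> x * \<bar>taylor2_rem f x t\<bar> \<le> \<epsilon> * (t - x)^2 / (1 + x) + C1 * (t - x)^4 / (1 + x^2)"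
    using weighted_rem_bound_far[OF assms] by blast
  obtain C2 where 2: "C2 \<ge> 0" "\<And>x t. 0 \<le> x \<Longrightarrow> x \<le> R \<Longrightarrow> t \<ge> 0 \<Longrightarrow>
      weight \<alpha> x * \<bar>taylor2_rem f x t\<bar> \<le> \<epsilon> * (t - x)^2 / (1 + x) + C2 * (t - x)^4 / (1 + x^2)"
    using weighted_rem_bound_near[OF \<alpha> _ 1(1) \<epsilon>, of f] f by blast
  show thesis
  proof (rule that[of "max C1 C2"])
    fix x t :: real assume x: "x \<ge> 0" and t: "t \<ge> 0"
    have le: "C * (t - x)^4 / (1 + x^2) \<le> max C1 C2 * (t - x)^4 / (1 + x^2)"
      if "C \<le> max C1 C2" for C
      using that by (intro divide_right_mono mult_right_mono) auto
    show "weight \<alpha> x * \<bar>taylor2_rem f x t\<bar>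
        \<le> \<epsilon> * (t - x)^2 / (1 + x) + max C1 C2 * (t - x)^4 / (1 + x^2)"
    proof (cases "x \<le> R")
      case True
      then show ?thesis using 2(2)[OF x True t] le[of C2] by linarith
    next
      case False
      then show ?thesis using 1(3)[of x t] t le[of C1] by linarith
    qed
  qed (use 1 in auto)
qed

lemma weighted_error_bound:
  assumes \<alpha>: "\<alpha> \<ge> 1" and f: "f \<in> C_inf_r 2 \<inter> A_domain \<alpha>" and \<epsilon>: "\<epsilon> > 0"
  obtains C where "\<And>n x. n \<ge> 1 \<Longrightarrow> x \<ge> 0 \<Longrightarrow>
    \<bar>weight \<alpha> x * (real n * (szasz n f x - f x) - A_op f x)\<bar> \<le> \<epsilon> + C / n"
proof -
  obtain C where C: "C \<ge> 0" "\<And>x t. x \<ge> 0 \<Longrightarrow> t \<ge> 0 \<Longrightarrow>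
      weight \<alpha> x * \<bar>taylor2_rem f x t\<bar> \<le> \<epsilon> * (t - x)^2 / (1 + x) + C * (t - x)^4 / (1 + x^2)"
    using weighted_rem_bound[OF assms] by blast
  obtain B where B: "\<And>t. t \<ge> 0 \<Longrightarrow> \<bar>f t\<bar> \<le> B"
    using C_inf_bounded[of f] f by (auto simp: C_inf_r_def)
  show thesis
  proof (rule that[of "4 * C"])
    fix n :: nat and x :: real assume n: "n \<ge> 1" and x: "x \<ge> 0"
    have w: "weight \<alpha> x > 0" using weight_bounds x by simp
    have "\<bar>real n * (szasz n f x - f x) - A_op f x\<bar>
        \<le> real n * 0 + \<epsilon> / (1 + x) / weight \<alpha> x * x
          + C / (1 + x^2) / weight \<alpha> x * (3 * x^2 + x / n) / n"
    proof (rule szasz_error_bound[OF n x B])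
      fix t :: real assume t: "t \<ge> 0"
      show "\<bar>taylor2_rem f x t\<bar> \<le> 0 + \<epsilon> / (1 + x) / weight \<alpha> x * (t - x)^2
          + C / (1 + x^2) / weight \<alpha> x * (t - x)^4"
      proof -
        have "\<bar>taylor2_rem f x t\<bar>
            \<le> (\<epsilon> * (t - x)^2 / (1 + x) + C * (t - x)^4 / (1 + x^2)) / weight \<alpha> x"
          using C(2)[OF x t] w by (simp add: pos_le_divide_eq mult.commute)
        then show ?thesis by (simp add: add_divide_distrib mult.commute)
      qed
    qed
    then have "weight \<alpha> x * \<bar>real n * (szasz n f x - f x) - A_op f x\<bar>
        \<le> weight \<alpha> x * (real n * 0 + \<epsilon> / (1 + x) / weight \<alpha> x * x
          + C / (1 + x^2) / weight \<alpha> x * (3 * x^2 + x / n) / n)"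
      using w by (intro mult_left_mono) auto
    also have "\<dots> = \<epsilon> * (x / (1 + x)) + C * ((3 * x^2 + x / n) / (1 + x^2)) / n"
    proof -
      have "weight \<alpha> x * (a / weight \<alpha> x * b) = a * b"
        "weight \<alpha> x * (a / weight \<alpha> x * b / c) = a * b / c" for a b c
        using w by simp_all
      then show ?thesis by (simp only: distrib_left[of "weight \<alpha> x"]) simp
    qed
    also have "\<dots> \<le> \<epsilon> * 1 + C * 4 / n"
    proof -
      have "x / (1 + x) \<le> 1" using x by simp
      moreover have "(3 * x^2 + x / n) / (1 + x^2) \<le> 4"
      proof -
        have "x / n \<le> x" using n x by (simp add: divide_le_eq mult_le_cancel_left1)
        moreover have "2 * x \<le> 1 + x^2" using zero_le_power2[of "x - 1"] by (simp add: power2_diff)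
        ultimately have "3 * x^2 + x / n \<le> 4 * (1 + x^2)"
          using zero_le_power2[of x] by (simp only: distrib_left)
        then show ?thesis by (simp add: divide_le_eq add_pos_nonneg)
      qed
      ultimately show ?thesis
        using \<epsilon> C(1) by (intro add_mono mult_left_mono divide_right_mono) auto
    qed
    finally show "\<bar>weight \<alpha> x * (real n * (szasz n f x - f x) - A_op f x)\<bar> \<le> \<epsilon> + 4 * C / n"
      using w by (simp add: abs_mult mult.commute)
  qed
qed

lemma wnorm_le:
  assumes "\<And>x. x \<ge> 0 \<Longrightarrow> \<bar>weight \<alpha> x * h x\<bar> \<le> c"
  shows "wnorm \<alpha> h \<le> ereal c"
  unfolding wnorm_def by (intro SUP_least) (use assms in auto)

lemma wnorm_nonneg: "wnorm \<alpha> h \<ge> 0"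
  unfolding wnorm_def by (rule SUP_upper2[of 0]) auto

theorem theorem1p4:
  "(\<forall>\<alpha>::real. 1 \<le> \<alpha> \<longrightarrow>
      (\<forall>f \<in> C_inf_r 2 \<inter> A_domain \<alpha>.
        (\<lambda>n::nat. wnorm \<alpha> (\<lambda>x. real n * (szasz n f x - f x) - A_op f x)) \<longlonglongrightarrow> 0)) \<and>
   (\<forall>\<alpha>::real. 3/2 < \<alpha> \<longrightarrow>
      (\<forall>f \<in> C_inf_r 2. (deriv0 ^^ 2) f \<in> Lip \<longrightarrow>
        (\<forall>n::nat. 1 \<le> n \<longrightarrow>
          wnorm \<alpha> (\<lambda>x. real n * (szasz n f x - f x) - A_op f x)
            \<le> ereal (1 / (6 * sqrt (real n)) * M_const \<alpha> * Lip_const ((deriv0 ^^ 2) f)))))"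
proof (intro conjI allI impI ballI)
  fix \<alpha> f assume \<alpha>: "1 \<le> \<alpha>" and f: "f \<in> C_inf_r 2 \<inter> A_domain \<alpha>"
  let ?e = "\<lambda>n. wnorm \<alpha> (\<lambda>x. real n * (szasz n f x - f x) - A_op f x)"
  show "?e \<longlonglongrightarrow> 0"
  proof (rule order_tendstoI)
    fix a :: ereal assume "a < 0"
    then show "\<forall>\<^sub>F n in sequentially. a < ?e n"
      using wnorm_nonneg less_le_trans by (intro always_eventually) blast
  next
    fix a :: ereal assume "0 < a"
    then obtain r where r: "0 < r" "ereal r < a"
      using ereal_dense2[of 0 a] by (auto simp: zero_ereal_def)
    obtain C where C: "\<And>n x. n \<ge> 1 \<Longrightarrow> x \<ge> 0 \<Longrightarrow>
        \<bar>weight \<alpha> x * (real n * (szasz n f x - f x) - A_op f x)\<bar> \<le> r / 2 + C / n"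
      using weighted_error_bound[OF \<alpha> f, of "r / 2"] r by auto
    have "(\<lambda>n. C / real n) \<longlonglongrightarrow> 0" by (rule lim_const_over_n)
    then have "\<forall>\<^sub>F n in sequentially. C / real n < r / 2"
      using r by (intro order_tendstoD) auto
    then show "\<forall>\<^sub>F n in sequentially. ?e n < a"
      using eventually_ge_at_top[of 1]
    proof eventually_elim
      case (elim n)
      have "?e n \<le> ereal (r / 2 + C / n)" by (rule wnorm_le) (use C elim in auto)
      also have "r / 2 + C / n \<le> r" using elim by linarith
      then have "ereal (r / 2 + C / n) \<le> ereal r" by simp
      also have "\<dots> < a" by (rule r)
      finally show ?case .
    qed
  qed
next
  fix \<alpha> :: real and f and n :: nat
  assume "3/2 < \<alpha>" "f \<in> C_inf_r 2" "(deriv0 ^^ 2) f \<in> Lip" "1 \<le> n"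
  then show "wnorm \<alpha> (\<lambda>x. real n * (szasz n f x - f x) - A_op f x)
      \<le> ereal (1 / (6 * sqrt (real n)) * M_const \<alpha> * Lip_const ((deriv0 ^^ 2) f))"
    by (intro wnorm_le weighted_error_bound_Lip)
qed

end
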